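(* (i) Let $n\geq 5$ and let $H_1,\dots,H_n$ be $n$ complex hyperplanes in $\mathbb{C}^3$ in general position. Then there exists a non-constant holomorphic curve $f:\mathbb{C}\to\mathbb{C}^3$ which avoids these $n$ hyperplanes, i.e. $f(\mathbb{C})\cap\bigcup_{i=1}^n H_i=\emptyset$, and such that $\pi(f)$ is constant. (ii) Let $H_1,H_2,H_3,H_4$ be four complex hyperplanes in $\mathbb{C}^3$ in general position. Then there exists a real subspace $H$ of $\mathbb{R}^6=\mathbb{C}^3$, of real dimension four, such that $(H,H_j,H_k)$ is in general position for all $j\neq k$, $j,k\in\{1,\dots,4\}$, and there exists a holomorphic map $f:\mathbb{C}\to\mathbb{C}^3$ such that $$f(\mathbb{C})\cap\Big(\bigcup_{i=1}^4 H_i\cup H\Big)=\emptyset$$ and $\pi(f)$ is non-constant.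
   Context: $\mathbb{R}^6$ with its standard complex structure is identified with $\mathbb{C}^3$ via $z_j=x_j+iy_j$, with real coordinates $(x_1,y_1,x_2,y_2,x_3,y_3)$. Complex hyperplanes of $\mathbb{C}^3$ are complex linear subspaces of complex dimension 2 (passing through the origin), and real subspaces are real linear subspaces of $\mathbb{R}^6$. For a real subspace $H$ of $\mathbb{R}^6$, $H^\perp$ denotes its orthogonal complement with respect to the Euclidean metric. A family $(H_1,\dots,H_n)$, $n\geq 3$, of real subspaces of $\mathbb{R}^6$ of real codimension 2 is said to be in general position if for every triple $(i,j,k)$ of distinct integers $i,j,k\in\{1,\dots,n\}$, $\mathrm{Span}_{\mathbb{R}}(H_i^\perp,H_j^\perp,H_k^\perp)=\mathbb{R}^6$. $\pi:\mathbb{C}^3\setminus\{0\}\to\mathbb{C}P^2$ denotes the canonical projection onto the complex projective plane, and $\pi(f):=\pi\circ f$, which is well defined when $f(\mathbb{C})\subset\mathbb{C}^3\setminus\{0\}$ (in particular whenever $f$ avoids a complex hyperplane through the origin). *)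

theory Defs
  imports "HOL-Complex_Analysis.Complex_Analysis"
begin

text \<open>
  The type \<^typ>\<open>complex^3\<close> serves both as $\mathbb{C}^3$ and as $\mathbb{R}^6$. Its complex structure is
  scalar multiplication \<open>*s\<close> with the notions \<open>vec.subspace\<close>, \<open>vec.dim\<close>; its structure as a
  Euclidean space is the one of class \<^class>\<open>euclidean_space\<close>, so that \<open>subspace\<close>, \<open>dim\<close>, \<open>span\<close>
  and \<open>orthogonal_comp\<close> are the real notions. The following two facts confirm that the
  inner product is the standard one of $\mathbb{R}^6$ in the coordinates $z_j = x_j + i y_j$.
\<close>

lemma DIM_complex3: "DIM(complex^3) = 6"
  by simp

lemma inner_complex3:
  fixes v w :: "complex^3"
  shows "v \<bullet> w = (\<Sum>j\<in>UNIV. Re (v $ j) * Re (w $ j) + Im (v $ j) * Im (w $ j))"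
  by (simp add: inner_vec_def inner_complex_def)

definition complex_hyperplane :: "(complex^3) set \<Rightarrow> bool" where
  "complex_hyperplane H \<longleftrightarrow> vec.subspace H \<and> vec.dim H = 2"

text \<open>A family of sets is given as a list, so its index set is \<open>{0..<n}\<close>.\<close>

definition general_position :: "(complex^3) set list \<Rightarrow> bool" where
  "general_position Hs \<longleftrightarrow>
     length Hs \<ge> 3 \<and>
     (\<forall>V\<in>set Hs. subspace V \<and> dim V + 2 = DIM(complex^3)) \<and>
     (\<forall>i<length Hs. \<forall>j<length Hs. \<forall>k<length Hs.
        i \<noteq> j \<and> j \<noteq> k \<and> i \<noteq> k \<longrightarrow>
        span (orthogonal_comp (Hs ! i) \<union> orthogonal_comp (Hs ! j) \<union> orthogonal_comp (Hs ! k)) = UNIV)"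

definition holomorphic_curve :: "(complex \<Rightarrow> complex^3) \<Rightarrow> bool" where
  "holomorphic_curve f \<longleftrightarrow> (\<forall>j. (\<lambda>z. f z $ j) holomorphic_on UNIV)"

definition proj_rel :: "((complex^3) \<times> (complex^3)) set" where
  "proj_rel = {(v, w). v \<noteq> 0 \<and> w \<noteq> 0 \<and> (\<exists>c. c \<noteq> 0 \<and> w = c *s v)}"

definition complex_projective_plane :: "(complex^3) set set" where
  "complex_projective_plane = (UNIV - {0}) // proj_rel"

text \<open>The canonical projection is meaningful for \<open>v \<noteq> 0\<close> only; it sends \<open>0\<close> to the empty set.\<close>

definition proj_plane :: "complex^3 \<Rightarrow> (complex^3) set" where
  "proj_plane v = proj_rel `` {v}"

lemma equiv_proj_rel: "equiv (UNIV - {0}) proj_rel"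
proof (rule equivI)
  show "proj_rel \<subseteq> (UNIV - {0}) \<times> (UNIV - {0})"
    by (auto simp: proj_rel_def)
  show "refl_on (UNIV - {0}) proj_rel"
    by (auto simp: refl_on_def proj_rel_def intro!: exI[of _ 1])
  show "sym proj_rel"
  proof (rule symI)
    fix v w assume "(v, w) \<in> proj_rel"
    then obtain c where "v \<noteq> 0" "w \<noteq> 0" "c \<noteq> 0" "w = c *s v"
      by (auto simp: proj_rel_def)
    then have "v = inverse c *s w" "inverse c \<noteq> 0"
      by (simp_all add: vector_smult_assoc)
    with \<open>v \<noteq> 0\<close> \<open>w \<noteq> 0\<close> show "(w, v) \<in> proj_rel"
      unfolding proj_rel_def by blast
  qed
  show "trans proj_rel"
  proof (rule transI)
    fix u v w assume "(u, v) \<in> proj_rel" "(v, w) \<in> proj_rel"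
    then obtain c d where "u \<noteq> 0" "w \<noteq> 0" "c \<noteq> 0" "d \<noteq> 0" "v = c *s u" "w = d *s v"
      by (auto simp: proj_rel_def)
    then have "w = (d * c) *s u" "d * c \<noteq> 0"
      by (simp_all add: vector_smult_assoc)
    with \<open>u \<noteq> 0\<close> \<open>w \<noteq> 0\<close> show "(u, w) \<in> proj_rel"
      unfolding proj_rel_def by blast
  qed
qed

lemma proj_plane_in_complex_projective_plane:
  "v \<noteq> 0 \<Longrightarrow> proj_plane v \<in> complex_projective_plane"
  by (auto simp: proj_plane_def complex_projective_plane_def intro: quotientI)

end

theory Submission
  imports Defs
begin

text \<open>
  (i) A finite union of proper subspaces omits some vector \<open>v\<close>, and \<open>f z = exp z *s v\<close> stays in the
  complex line through \<open>v\<close>.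

  (ii) In suitable complex linear coordinates \<open>w = A z\<close> the four hyperplanes are \<open>w\<^sub>1 = 0\<close>, \<open>w\<^sub>2 = 0\<close>,
  \<open>w\<^sub>3 = 0\<close> and \<open>w\<^sub>1 + w\<^sub>2 + w\<^sub>3 = 0\<close>. The curve \<open>w = (exp z, exp (- z), - exp (- z))\<close> avoids
  them; it also avoids the real subspace \<open>w\<^sub>1 + 3 cnj w\<^sub>2 + 2 cnj w\<^sub>3 = 0\<close>, because on the curve
  the left-hand side is \<open>exp z + exp (- cnj z)\<close>, and this vanishes only if the positive number
  \<open>exp (2 Re z)\<close> equals \<open>-1\<close>.
\<close>

section \<open>General position as trivial intersection\<close>

text \<open>The complement of the span is the intersection of the double complements, which are
  \<open>A\<close>, \<open>B\<close>, \<open>C\<close> themselves; and a subspace is the whole space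
  exactly when its complement is trivial.\<close>

lemma span_Un_orthogonal_comp_eq_UNIV_iff:
  fixes A B C :: "'a::euclidean_space set"
  assumes "subspace A" "subspace B" "subspace C"
  shows "span (A\<^sup>\<bottom> \<union> B\<^sup>\<bottom> \<union> C\<^sup>\<bottom>) = UNIV \<longleftrightarrow> A \<inter> B \<inter> C = {0}"
proof -
  let ?S = "A\<^sup>\<bottom> \<union> B\<^sup>\<bottom> \<union> C\<^sup>\<bottom>"
  have "(span ?S)\<^sup>\<bottom> = A\<^sup>\<bottom>\<^sup>\<bottom> \<inter> B\<^sup>\<bottom>\<^sup>\<bottom> \<inter> C\<^sup>\<bottom>\<^sup>\<bottom>"
  proof
    show "(span ?S)\<^sup>\<bottom> \<subseteq> A\<^sup>\<bottom>\<^sup>\<bottom> \<inter> B\<^sup>\<bottom>\<^sup>\<bottom> \<inter> C\<^sup>\<bottom>\<^sup>\<bottom>"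
      by (auto simp: orthogonal_comp_def intro: span_base)
    show "A\<^sup>\<bottom>\<^sup>\<bottom> \<inter> B\<^sup>\<bottom>\<^sup>\<bottom> \<inter> C\<^sup>\<bottom>\<^sup>\<bottom> \<subseteq> (span ?S)\<^sup>\<bottom>"
    proof
      fix x assume "x \<in> A\<^sup>\<bottom>\<^sup>\<bottom> \<inter> B\<^sup>\<bottom>\<^sup>\<bottom> \<inter> C\<^sup>\<bottom>\<^sup>\<bottom>"
      moreover have "orthogonal x y" if "x \<in> U\<^sup>\<bottom>" "y \<in> U" for U y
        using that orthogonal_commute[of x y] by (simp add: orthogonal_comp_def)
      ultimately have "orthogonal x y" if "y \<in> ?S" for y
        using that by blast
      then have "orthogonal x y" if "y \<in> span ?S" for y
        using orthogonal_to_span that by blast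
      then show "x \<in> (span ?S)\<^sup>\<bottom>"
        by (auto simp: orthogonal_comp_def orthogonal_commute)
    qed
  qed
  then have "(span ?S)\<^sup>\<bottom> = A \<inter> B \<inter> C"
    using assms by (simp add: orthogonal_comp_self)
  then show ?thesis
    by (metis orthogonal_comp_UNIV orthogonal_comp_null orthogonal_comp_self subspace_span)
qed

lemma general_position_Int:
  assumes "general_position Hs" "i < length Hs" "j < length Hs" "k < length Hs"
    and "i \<noteq> j" "j \<noteq> k" "i \<noteq> k"
  shows "Hs ! i \<inter> Hs ! j \<inter> Hs ! k = {0}"
  using assms unfolding general_position_def
  by (metis nth_mem span_Un_orthogonal_comp_eq_UNIV_iff)

text \<open>All six orderings of the three members lead to the same intersection, and real dimension
  4 is codimension 2.\<close>

lemma general_position_3I: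
  assumes "subspace U" "subspace V" "subspace W" "dim U = 4" "dim V = 4" "dim W = 4"
    and "U \<inter> V \<inter> W = {0}"
  shows "general_position [U, V, W]"
proof -
  have perms: "V \<inter> U \<inter> W = {0}" "U \<inter> W \<inter> V = {0}" "V \<inter> W \<inter> U = {0}"
    "W \<inter> U \<inter> V = {0}" "W \<inter> V \<inter> U = {0}"
    using assms(7) by auto
  show ?thesis
    unfolding general_position_def
    using assms perms
    by (auto simp: less_Suc_eq numeral_3_eq_3 span_Un_orthogonal_comp_eq_UNIV_iff)
qed

section \<open>Linear equations and a normal form for four hyperplanes\<close>

text \<open>A basis of \<open>V\<close> together with one vector \<open>a\<close> outside
  \<open>V\<close> is a basis of the whole space; the form that kills the former and is 1 at
  \<open>a\<close> has kernel \<open>V\<close>. The pairing is bilinear, without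
  conjugation.\<close>

lemma complex_hyperplane_equation:
  assumes "complex_hyperplane V"
  obtains n :: "complex^3" where "V = {z. (\<Sum>i\<in>UNIV. n $ i * z $ i) = 0}"
proof -
  have V: "vec.subspace V" "vec.dim V = 2"
    using assms by (auto simp: complex_hyperplane_def)
  obtain B where B: "B \<subseteq> V" "vec.independent B" "V \<subseteq> vec.span B" "card B = vec.dim V"
    using vec.basis_exists by metis
  have spB: "vec.span B = V"
    using B V(1) by (metis vec.span_subspace)
  have "V \<noteq> UNIV"
    using V(2) vec_dim_card[where 'a = complex and 'n = 3] by auto
  then obtain a where a: "a \<notin> V" by auto
  have ind: "vec.independent (insert a B)"
    using B(2) a spB by (simp add: vec.independent_insert)
  have finB: "finite B" using B(2) vec.finiteI_independent by blast
  have "card (insert a B) = 3"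
    using a B V finB by (subst card_insert_disjoint) auto
  then have spaB: "vec.span (insert a B) = UNIV"
    using ind vec.card_ge_dim_independent[of "insert a B" UNIV]
      vec_dim_card[where 'a = complex and 'n = 3] by auto
  \<comment> \<open>The form is taken as the first coordinate of an endomorphism, so that its
    coefficients are the first row of \<open>matrix g\<close>.\<close>
  obtain g where g: "Vector_Spaces.linear (*s) (*s) g"
    and ga: "\<forall>x\<in>insert a B. g x = (if x = a then axis 1 1 else (0::complex^3))"
    using vec.linear_independent_extend[OF ind, of "\<lambda>x. if x = a then axis 1 1 else 0"] by blast
  interpret g: Vector_Spaces.linear "(*s)" "(*s)" g by fact
  have g0: "g b = 0" if "b \<in> V" for b
  proof -
    have "b \<in> vec.span B" using that spB by simp
    moreover have "g x = 0" if "x \<in> B" for x using ga a B(1) that by auto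
    ultimately show ?thesis using g.eq_0_on_span by blast
  qed
  have mem: "z \<in> V \<longleftrightarrow> g z $ 1 = 0" for z
  proof -
    have "z \<in> vec.span (insert a B)" using spaB by simp
    then obtain k where k: "z - k *s a \<in> V"
      using vec.span_breakdown_eq spB by blast
    have "g z = g (z - k *s a) + k *s g a"
      by (simp add: g.diff g.scale)
    then have gz: "g z = k *s axis 1 1"
      using g0[OF k] ga by simp
    show ?thesis
    proof
      assume "z \<in> V" then show "g z $ 1 = 0" using g0 by simp
    next
      assume "g z $ 1 = 0"
      then have "k = 0" using gz by (simp add: axis_def)
      then show "z \<in> V" using k by simp
    qed
  qed
  have "g z $ 1 = (\<Sum>i\<in>UNIV. (matrix g $ 1) $ i * z $ i)" for z
    unfolding matrix_works[OF g, of z, symmetric] by (simp add: matrix_vector_mult_def)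
  then have "V = {z. (\<Sum>i\<in>UNIV. (matrix g $ 1) $ i * z $ i) = 0}"
    using mem by (simp only: set_eq_iff mem_Collect_eq) simp
  then show ?thesis by (rule that)
qed

text \<open>The forms of the first three hyperplanes are independent, so the fourth is a combination
  of them. The other three intersection conditions make its coefficients nonzero, and these can then
  be absorbed into the coordinates.\<close>

lemma four_hyperplanes_normal_form:
  assumes hyp: "complex_hyperplane H1" "complex_hyperplane H2"
      "complex_hyperplane H3" "complex_hyperplane H4"
    and int: "H1 \<inter> H2 \<inter> H3 = {0}" "H2 \<inter> H3 \<inter> H4 = {0}"
      "H1 \<inter> H3 \<inter> H4 = {0}" "H1 \<inter> H2 \<inter> H4 = {0}"
  obtains A B :: "complex^3^3" where "A ** B = mat 1" "B ** A = mat 1"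
    "H1 = {z. (A *v z) $ 1 = 0}" "H2 = {z. (A *v z) $ 2 = 0}" "H3 = {z. (A *v z) $ 3 = 0}"
    "H4 = {z. (A *v z) $ 1 + (A *v z) $ 2 + (A *v z) $ 3 = 0}"
proof -
  define form where "form n z = (\<Sum>i\<in>UNIV. n $ i * z $ i)" for n z :: "complex^3"
  obtain n1 where n1: "H1 = {z. form n1 z = 0}"
    unfolding form_def using complex_hyperplane_equation[OF hyp(1)] .
  obtain n2 where n2: "H2 = {z. form n2 z = 0}"
    unfolding form_def using complex_hyperplane_equation[OF hyp(2)] .
  obtain n3 where n3: "H3 = {z. form n3 z = 0}"
    unfolding form_def using complex_hyperplane_equation[OF hyp(3)] .
  obtain n4 where n4: "H4 = {z. form n4 z = 0}"
    unfolding form_def using complex_hyperplane_equation[OF hyp(4)] .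
  define A0 :: "complex^3^3" where "A0 = vector [n1, n2, n3]"
  have A0: "(A0 *v z) $ 1 = form n1 z" "(A0 *v z) $ 2 = form n2 z" "(A0 *v z) $ 3 = form n3 z" for z
    by (simp_all add: A0_def matrix_vector_mult_def form_def)
  have "z = 0" if "A0 *v z = 0" for z
  proof -
    have "z \<in> H1 \<inter> H2 \<inter> H3" using that A0[of z] n1 n2 n3 by simp
    then show ?thesis using int(1) by simp
  qed
  then obtain B0 where B0: "B0 ** A0 = mat 1"
    using matrix_left_invertible_ker by blast
  then have B0': "A0 ** B0 = mat 1"
    using matrix_left_right_inverse by blast
  \<comment> \<open>The coefficients of the fourth form in terms of the first three:
    \<open>n4\<close> is the row vector \<open>c\<close> times \<open>A0\<close>.\<close>
  define c where "c = n4 v* B0"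
  have form4: "form n4 z = c $ 1 * form n1 z + c $ 2 * form n2 z + c $ 3 * form n3 z" for z
  proof -
    have "form n4 z = form n4 (B0 *v (A0 *v z))"
      using B0 by (simp add: matrix_vector_mul_assoc)
    also have "\<dots> = form c (A0 *v z)"
      unfolding c_def form_def matrix_vector_mult_def vector_matrix_mult_def
      by (simp add: sum_3 algebra_simps)
    also have "\<dots> = c $ 1 * form n1 z + c $ 2 * form n2 z + c $ 3 * form n3 z"
      by (simp add: form_def[of c] sum_3 A0)
    finally show ?thesis .
  qed
  \<comment> \<open>The vectors \<open>B0 *v axis i 1\<close> form the basis dual to
    \<open>n1\<close>, \<open>n2\<close>, \<open>n3\<close>. Each lies on two of the first three
    hyperplanes, and the fourth form takes the value \<open>c $ i\<close> there.\<close>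
  have e: "A0 *v (B0 *v axis i 1) = axis i 1" "B0 *v axis i 1 \<noteq> 0" for i
  proof -
    show *: "A0 *v (B0 *v axis i 1) = axis i 1"
      using B0' by (simp add: matrix_vector_mul_assoc)
    show "B0 *v axis i 1 \<noteq> 0"
      using * by (metis axis_eq_0_iff matrix_vector_mult_0_right zero_neq_one)
  qed
  have fe: "form n1 (B0 *v axis i 1) = axis i 1 $ 1" "form n2 (B0 *v axis i 1) = axis i 1 $ 2"
    "form n3 (B0 *v axis i 1) = axis i 1 $ 3" for i
    by (simp_all flip: A0 add: e)
  have c0: "c $ 1 \<noteq> 0" "c $ 2 \<noteq> 0" "c $ 3 \<noteq> 0"
  proof -
    show "c $ 1 \<noteq> 0"
    proof
      assume "c $ 1 = 0"
      then have "B0 *v axis 1 1 \<in> H2 \<inter> H3 \<inter> H4"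
        unfolding n2 n3 n4 by (simp add: form4 fe) (simp add: axis_def)
      then show False using e(2) int(2) by blast
    qed
    show "c $ 2 \<noteq> 0"
    proof
      assume "c $ 2 = 0"
      then have "B0 *v axis 2 1 \<in> H1 \<inter> H3 \<inter> H4"
        unfolding n1 n3 n4 by (simp add: form4 fe) (simp add: axis_def)
      then show False using e(2) int(3) by blast
    qed
    show "c $ 3 \<noteq> 0"
    proof
      assume "c $ 3 = 0"
      then have "B0 *v axis 3 1 \<in> H1 \<inter> H2 \<inter> H4"
        unfolding n1 n2 n4 by (simp add: form4 fe) (simp add: axis_def)
      then show False using e(2) int(4) by blast
    qed
  qed
  \<comment> \<open>Rescaling the rows by \<open>c\<close> turns the fourth form into the sum of the
    three coordinates.\<close>
  define A :: "complex^3^3" where "A = vector [c $ 1 *s n1, c $ 2 *s n2, c $ 3 *s n3]"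
  have A: "(A *v z) $ 1 = c $ 1 * form n1 z" "(A *v z) $ 2 = c $ 2 * form n2 z"
    "(A *v z) $ 3 = c $ 3 * form n3 z" for z
    by (simp_all add: A_def matrix_vector_mult_def form_def sum_distrib_left mult.assoc)
  have H: "H1 = {z. (A *v z) $ 1 = 0}" "H2 = {z. (A *v z) $ 2 = 0}" "H3 = {z. (A *v z) $ 3 = 0}"
    "H4 = {z. (A *v z) $ 1 + (A *v z) $ 2 + (A *v z) $ 3 = 0}"
    using c0 by (auto simp: A n1 n2 n3 n4 form4)
  have "z = 0" if "A *v z = 0" for z
  proof -
    have "z \<in> H1 \<inter> H2 \<inter> H3" unfolding H using that by simp
    then show ?thesis using int(1) by simp
  qed
  then obtain B where B: "B ** A = mat 1"
    using matrix_left_invertible_ker by blast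
  then have "A ** B = mat 1"
    using matrix_left_right_inverse by blast
  with B H show ?thesis using that by blast
qed

section \<open>Projective classes and a curve inside one complex line\<close>

lemma proj_plane_eq_iff:
  assumes "v \<noteq> 0" "w \<noteq> 0"
  shows "proj_plane v = proj_plane w \<longleftrightarrow> (\<exists>c. w = c *s v)"
proof -
  have "proj_plane v = proj_plane w \<longleftrightarrow> (v, w) \<in> proj_rel"
    unfolding proj_plane_def using equiv_proj_rel assms by (intro eq_equiv_class_iff) auto
  also have "\<dots> \<longleftrightarrow> (\<exists>c. w = c *s v)"
    using assms by (auto simp: proj_rel_def)
  finally show ?thesis .
qed

lemma curve_avoiding_hyperplanes_constant_proj:
  assumes len: "Hs \<noteq> []" and hyp: "\<forall>V\<in>set Hs. complex_hyperplane V"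
    and gp: "general_position Hs"
  shows "\<exists>f. holomorphic_curve f \<and> \<not> f constant_on UNIV \<and>
    range f \<inter> \<Union>(set Hs) = {} \<and> (proj_plane \<circ> f) constant_on UNIV"
proof -
  \<comment> \<open>Each hyperplane is a Lebesgue null set, and so is their finite union, which
    therefore cannot be everything.\<close>
  have "negligible (\<Union>(set Hs))"
  proof (intro negligible_Union negligible_lowdim)
    fix V assume "V \<in> set Hs"
    then have "dim V + 2 = DIM(complex^3)" using gp by (auto simp: general_position_def)
    then show "dim V < DIM(complex^3)" by linarith
  qed auto
  then obtain v where v: "v \<notin> \<Union>(set Hs)"
    using non_negligible_UNIV by (metis UNIV_eq_I)
  have zero: "0 \<in> V" and smult: "c *s x \<in> V \<Longrightarrow> c \<noteq> 0 \<Longrightarrow> x \<in> V" if "V \<in> set Hs" for V c and x :: "complex^3"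
  proof -
    have sub: "vec.subspace V" using that hyp by (simp add: complex_hyperplane_def)
    then show "0 \<in> V" by (rule vec.subspace_0)
    show "x \<in> V" if "c *s x \<in> V" "c \<noteq> 0"
      using vec.subspace_scale[OF sub that(1), of "inverse c"] that(2)
      by (simp add: vector_smult_assoc)
  qed
  \<comment> \<open>Nonemptiness of the list matters here: 0 lies on some hyperplane, while
    \<open>v\<close> lies on none.\<close>
  have v0: "v \<noteq> 0" using v zero len by (metis UnionI list.set_intros(1) neq_Nil_conv)
  define f where "f z = exp z *s v" for z :: complex
  have f0: "f z \<noteq> 0" for z using v0 by (simp add: f_def)
  have fV: "f z \<notin> V" if "V \<in> set Hs" for z V
    using smult[OF that, of "exp z" v] v that by (auto simp: f_def)
  have "holomorphic_curve f"
    unfolding holomorphic_curve_def f_def by (auto intro!: holomorphic_intros)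
  moreover have "\<not> f constant_on UNIV"
  proof
    assume "f constant_on UNIV"
    \<comment> \<open>The exponential is 1 at the first point and -1 at the second.\<close>
    then have "f 0 = f (\<i> * pi)" unfolding constant_on_def by (metis UNIV_I)
    then have "v $ i = - v $ i" for i by (simp add: f_def exp_pi_i' vec_eq_iff)
    then show False using v0 by (simp add: vec_eq_iff)
  qed
  moreover have "range f \<inter> \<Union>(set Hs) = {}"
    using fV by blast
  moreover have "(proj_plane \<circ> f) constant_on UNIV"
  proof -
    have "proj_plane (f z) = proj_plane v" for z
      using proj_plane_eq_iff[OF v0 f0] unfolding f_def by blast
    then show ?thesis by (auto simp: constant_on_def)
  qed
  ultimately show ?thesis by blast
qed

section \<open>The additional real subspace and a curve with nonconstant projection\<close>

lemma vec3_eq_iff: "v = w \<longleftrightarrow> v $ 1 = w $ 1 \<and> v $ 2 = w $ 2 \<and> v $ 3 = w $ 3" for v w :: "'a^3"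
  by (simp add: vec_eq_iff forall_3)

text \<open>The second assumption lists the six complex lines in which two of the four hyperplanes
  meet. On coordinate axes a single term survives; on the other three lines two terms do, in
  variables of equal modulus, and they cannot cancel because the coefficients 1, 3, 2 are
  distinct.\<close>

lemma real_subspace_meets_lines_trivially:
  fixes a b c :: complex
  assumes "a + 3 * cnj b + 2 * cnj c = 0"
    and "a = 0 \<and> b = 0 \<or> a = 0 \<and> c = 0 \<or> b = 0 \<and> c = 0 \<or>
      a + b + c = 0 \<and> (a = 0 \<or> b = 0 \<or> c = 0)"
  shows "a = 0 \<and> b = 0 \<and> c = 0"
  using assms by (elim disjE conjE; simp add: complex_eq_iff)

lemma curve_avoiding_hyperplanes_nonconstant_proj:
  assumes len: "length Hs = 4" and hyp: "\<forall>V\<in>set Hs. complex_hyperplane V"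
    and gp: "general_position Hs"
  shows "\<exists>H. subspace H \<and> dim H = 4 \<and>
    (\<forall>j<4. \<forall>k<4. j \<noteq> k \<longrightarrow> general_position [H, Hs ! j, Hs ! k]) \<and>
    (\<exists>f. holomorphic_curve f \<and> range f \<inter> (\<Union>(set Hs) \<union> H) = {} \<and>
      \<not> (proj_plane \<circ> f) constant_on UNIV)"
proof -
  have hyp': "complex_hyperplane (Hs ! 0)" "complex_hyperplane (Hs ! 1)"
    "complex_hyperplane (Hs ! 2)" "complex_hyperplane (Hs ! 3)"
    using len by (auto intro!: bspec[OF hyp] nth_mem)
  have int: "Hs ! 0 \<inter> Hs ! 1 \<inter> Hs ! 2 = {0}" "Hs ! 1 \<inter> Hs ! 2 \<inter> Hs ! 3 = {0}"
    "Hs ! 0 \<inter> Hs ! 2 \<inter> Hs ! 3 = {0}" "Hs ! 0 \<inter> Hs ! 1 \<inter> Hs ! 3 = {0}"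
    by (rule general_position_Int[OF gp]; simp add: len)+
  obtain A B :: "complex^3^3" where AB: "A ** B = mat 1" "B ** A = mat 1"
    and H: "Hs ! 0 = {z. (A *v z) $ 1 = 0}" "Hs ! 1 = {z. (A *v z) $ 2 = 0}"
      "Hs ! 2 = {z. (A *v z) $ 3 = 0}"
      "Hs ! 3 = {z. (A *v z) $ 1 + (A *v z) $ 2 + (A *v z) $ 3 = 0}"
    by (rule four_hyperplanes_normal_form[OF hyp' int])
  have ABv [simp]: "A *v (B *v w) = w" "B *v (A *v w) = w" for w
    using AB by (simp_all add: matrix_vector_mul_assoc)
  \<comment> \<open>The conjugations make \<open>L\<close> only real linear. The coefficients 3 and
    2 differ by 1, so on the curve below the last two terms combine to
    \<open>cnj (exp (- z))\<close>.\<close>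
  define L where "L w = w $ 1 + 3 * cnj (w $ 2) + 2 * cnj (w $ 3)" for w :: "complex^3"
  define K where "K = {z. L (A *v z) = 0}"
  \<comment> \<open>Solving \<open>L w = 0\<close> for the first coordinate parametrises
    \<open>K\<close> by the other two, so \<open>K\<close> inherits real dimension 4 from
    \<open>complex \<times> complex\<close>.\<close>
  define g where "g p = B *v vector [- (3 * cnj (fst p) + 2 * cnj (snd p)), fst p, snd p]"
    for p :: "complex \<times> complex"
  have "linear g"
    unfolding g_def
    by (rule linearI)
      (simp_all add: vec3_eq_iff matrix_vector_mult_def sum_3 algebra_simps
        scaleR_conv_of_real[where 'a = complex])
  moreover have "inj g"
  proof (rule injI)
    fix p q assume "g p = g q"
    then have "A *v g p = A *v g q" by simp
    then show "p = q" by (simp add: g_def vec3_eq_iff prod_eq_iff)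
  qed
  moreover have "K = range g"
  proof (intro equalityI subsetI)
    fix z assume "z \<in> K"
    then have "(A *v z) $ 1 = - (3 * cnj ((A *v z) $ 2) + 2 * cnj ((A *v z) $ 3))"
      unfolding K_def L_def mem_Collect_eq by (simp only: add.assoc eq_neg_iff_add_eq_0)
    then have "A *v z = A *v g ((A *v z) $ 2, (A *v z) $ 3)"
      unfolding g_def by (simp add: vec3_eq_iff)
    then have "z = g ((A *v z) $ 2, (A *v z) $ 3)" by (metis ABv(2))
    then show "z \<in> range g" by blast
  qed (auto simp: K_def L_def g_def)
  ultimately have K: "subspace K" "dim K = 4"
    by (auto simp: linear_subspace_image dim_image_eq)
  have gpK: "general_position [K, Hs ! j, Hs ! k]" if jk: "j < 4" "k < 4" "j \<noteq> k" for j k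
  proof (rule general_position_3I)
    have "z = 0" if "L (A *v z) = 0" "z \<in> Hs ! j" "z \<in> Hs ! k" for z
    proof -
      \<comment> \<open>Applied to two distinct indices, this yields exactly the case distinction of
        \<open>real_subspace_meets_lines_trivially\<close>.\<close>
      have coord: "i = 0 \<and> (A *v z) $ 1 = 0 \<or> i = 1 \<and> (A *v z) $ 2 = 0 \<or> i = 2 \<and> (A *v z) $ 3 = 0 \<or>
          i = 3 \<and> (A *v z) $ 1 + (A *v z) $ 2 + (A *v z) $ 3 = 0"
        if "i < 4" "z \<in> Hs ! i" for i
      proof -
        have "i = 0 \<or> i = 1 \<or> i = 2 \<or> i = 3" using that(1) by linarith
        then show ?thesis using that(2) by (elim disjE) (simp_all add: H del: One_nat_def)
      qed
      have "(A *v z) $ 1 = 0 \<and> (A *v z) $ 2 = 0 \<and> (A *v z) $ 3 = 0"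
      proof (rule real_subspace_meets_lines_trivially)
        show "(A *v z) $ 1 + 3 * cnj ((A *v z) $ 2) + 2 * cnj ((A *v z) $ 3) = 0"
          using that(1) by (simp add: L_def)
      qed (use coord[OF jk(1) that(2)] coord[OF jk(2) that(3)] jk(3) in
          \<open>elim disjE conjE; simp\<close>)
      then have "A *v z = 0" by (simp add: vec3_eq_iff)
      then show "z = 0" by (metis ABv(2) matrix_vector_mult_0_right)
    qed
    moreover have "subspace (Hs ! j)" "subspace (Hs ! k)" "dim (Hs ! j) = 4" "dim (Hs ! k) = 4"
      using gp jk len by (auto simp: general_position_def)
    moreover have "0 \<in> K \<inter> Hs ! j \<inter> Hs ! k"
      using K calculation(2,3) by (simp add: subspace_0)
    ultimately show "subspace (Hs ! j)" "subspace (Hs ! k)" "dim (Hs ! j) = 4" "dim (Hs ! k) = 4"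
      "K \<inter> Hs ! j \<inter> Hs ! k = {0}"
      by (auto simp: K_def)
  qed (use K in auto)
  \<comment> \<open>The last two coordinates cancel, so the fourth form agrees with the first on the
    curve and equals \<open>exp z\<close>.\<close>
  define f where "f z = B *v vector [exp z, exp (- z), - exp (- z)]" for z :: complex
  have Af: "(A *v f z) $ 1 = exp z" "(A *v f z) $ 2 = exp (- z)" "(A *v f z) $ 3 = - exp (- z)" for z
    by (simp_all add: f_def)
  have hol: "holomorphic_curve f"
    unfolding holomorphic_curve_def f_def matrix_vector_mult_def
    by (auto simp: sum_3 intro!: holomorphic_intros)
  have "f z \<notin> Hs ! i" if "i < 4" for z i
  proof -
    have "i \<in> {0, 1, 2, 3}" using that by auto
    then show ?thesis by (auto simp: H Af simp del: One_nat_def)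
  qed
  then have avoid_Hs: "range f \<inter> \<Union>(set Hs) = {}"
    using len by (auto simp: in_set_conv_nth)
  have "f z \<notin> K" for z
  proof
    assume "f z \<in> K"
    then have "exp z + exp (- cnj z) = 0"
      by (simp add: K_def L_def Af exp_cnj algebra_simps)
    then have "exp z * exp (cnj z) = - 1"
      by (simp add: exp_minus field_simps add_eq_0_iff)
    then have "exp (of_real (2 * Re z)) = (- 1 :: complex)"
      by (simp only: exp_add[symmetric] complex_add_cnj)
    then have "complex_of_real (exp (2 * Re z)) = of_real (- 1)"
      by (simp only: exp_of_real of_real_minus of_real_1)
    then have "exp (2 * Re z) = - 1"
      by (simp only: of_real_eq_iff)
    then show False using exp_gt_zero[of "2 * Re z"] by linarith
  qed
  then have "range f \<inter> (\<Union>(set Hs) \<union> K) = {}"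
    using avoid_Hs by blast
  moreover have "\<not> (proj_plane \<circ> f) constant_on UNIV"
  proof
    assume "(proj_plane \<circ> f) constant_on UNIV"
    \<comment> \<open>In the new coordinates \<open>f 0\<close> is \<open>(1, 1, -1)\<close>, so a
      multiple of it has equal first and second coordinates; at \<open>Ln \<i>\<close> these are
      \<open>\<i>\<close> and its inverse.\<close>
    then have "proj_plane (f 0) = proj_plane (f (Ln \<i>))"
      unfolding constant_on_def by (metis UNIV_I comp_apply)
    moreover have "f z \<noteq> 0" for z
      using Af(1)[of z] by auto
    ultimately obtain c where "f (Ln \<i>) = c *s f 0"
      using proj_plane_eq_iff by blast
    then have "A *v f (Ln \<i>) = c *s (A *v f 0)"
      by (simp add: vec.scale)
    then have "exp (Ln \<i>) = c" "exp (- Ln \<i>) = c"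
      unfolding vec3_eq_iff by (simp_all add: Af)
    then have "exp (Ln \<i>) = inverse (exp (Ln \<i>))"
      by (simp only: exp_minus)
    then have "\<i> = inverse \<i>"
      unfolding exp_Ln[OF complex_i_not_zero] .
    then show False by simp
  qed
  ultimately have "\<exists>f. holomorphic_curve f \<and> range f \<inter> (\<Union>(set Hs) \<union> K) = {} \<and>
      \<not> (proj_plane \<circ> f) constant_on UNIV"
    using hol by blast
  with K gpK show ?thesis by blast
qed

theorem theorem1:
  shows
    "(\<forall>Hs. length Hs \<ge> 5 \<and> (\<forall>V\<in>set Hs. complex_hyperplane V) \<and> general_position Hs \<longrightarrow>
        (\<exists>f. holomorphic_curve f \<and> \<not> f constant_on UNIV \<and>
             range f \<inter> \<Union>(set Hs) = {} \<and>
             (proj_plane \<circ> f) constant_on UNIV))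
     \<and>
     (\<forall>Hs. length Hs = 4 \<and> (\<forall>V\<in>set Hs. complex_hyperplane V) \<and> general_position Hs \<longrightarrow>
        (\<exists>H. subspace H \<and> dim H = 4 \<and>
             (\<forall>j<4. \<forall>k<4. j \<noteq> k \<longrightarrow> general_position [H, Hs ! j, Hs ! k]) \<and>
             (\<exists>f. holomorphic_curve f \<and>
                  range f \<inter> (\<Union>(set Hs) \<union> H) = {} \<and>
                  \<not> (proj_plane \<circ> f) constant_on UNIV)))"
proof (intro conjI allI impI; elim conjE)
  fix Hs :: "(complex^3) set list"
  assume "5 \<le> length Hs" "\<forall>V\<in>set Hs. complex_hyperplane V" "general_position Hs"
  then show "\<exists>f. holomorphic_curve f \<and> \<not> f constant_on UNIV \<and>
      range f \<inter> \<Union>(set Hs) = {} \<and> (proj_plane \<circ> f) constant_on UNIV"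
    by (intro curve_avoiding_hyperplanes_constant_proj) auto
next
  fix Hs :: "(complex^3) set list"
  assume "length Hs = 4" "\<forall>V\<in>set Hs. complex_hyperplane V" "general_position Hs"
  then show "\<exists>H. subspace H \<and> dim H = 4 \<and>
      (\<forall>j<4. \<forall>k<4. j \<noteq> k \<longrightarrow> general_position [H, Hs ! j, Hs ! k]) \<and>
      (\<exists>f. holomorphic_curve f \<and> range f \<inter> (\<Union>(set Hs) \<union> H) = {} \<and>
        \<not> (proj_plane \<circ> f) constant_on UNIV)"
    by (rule curve_avoiding_hyperplanes_nonconstant_proj)
qed

end
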